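(* Let $X$ be a finite nonempty set of keys, $\Sigma$ a set, $q\in\mathbb{N}$ with $q\ge 1$, $m\in\mathbb{N}$, let $\mathcal{H}=\{h_x:\Sigma\to[2^q]\}_{x\in X}$ be any family of functions, and let $\sigma:\{0,\dots,q-1\}\times\{0,\dots,m\}\to\Sigma$ be injective. Define $\tilde f(x,2^r)$ for $x\in X$ and $r\in\{0,\dots,q\}$ as follows: $a= h_x(\sigma(0,0))\bmod 2^r$; $b=\lfloor\log_2 a\rfloor$ if $a>0$ and $b=0$ otherwise; $c=h_x(\sigma(b,0))\bmod 2^b$; $\tilde f(x,2^r)=a\oplus c$. Then $\tilde f$ is monotone: for all $x\in X$ and all $r,r'\in\{0,\dots,q\}$ with $r<r'$, if $\tilde f(x,2^{r'})<2^r$ then $\tilde f(x,2^{r'})=\tilde f(x,2^r)$.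
   Context: $[N]=\{0,1,\dots,N-1\}$. $\oplus$ denotes bitwise exclusive-or of nonnegative integers in binary. Note $\tilde f(x,2^r)\in[2^r]$. *)

theory Defs
  imports Complex_Main "HOL-Library.FuncSet"
begin

text \<open>The argument \<open>N\<close> is the size of the range, intended to be a power of two.\<close>

definition ftilde_a :: "('k \<Rightarrow> 's \<Rightarrow> nat) \<Rightarrow> (nat \<times> nat \<Rightarrow> 's) \<Rightarrow> 'k \<Rightarrow> nat \<Rightarrow> nat" where
  "ftilde_a h \<sigma> x N = h x (\<sigma> (0, 0)) mod N"

definition ftilde_b :: "('k \<Rightarrow> 's \<Rightarrow> nat) \<Rightarrow> (nat \<times> nat \<Rightarrow> 's) \<Rightarrow> 'k \<Rightarrow> nat \<Rightarrow> nat" where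
  "ftilde_b h \<sigma> x N =
     (if ftilde_a h \<sigma> x N > 0 then nat \<lfloor>log 2 (real (ftilde_a h \<sigma> x N))\<rfloor> else 0)"

definition ftilde_c :: "('k \<Rightarrow> 's \<Rightarrow> nat) \<Rightarrow> (nat \<times> nat \<Rightarrow> 's) \<Rightarrow> 'k \<Rightarrow> nat \<Rightarrow> nat" where
  "ftilde_c h \<sigma> x N = h x (\<sigma> (ftilde_b h \<sigma> x N, 0)) mod 2 ^ ftilde_b h \<sigma> x N"

definition ftilde :: "('k \<Rightarrow> 's \<Rightarrow> nat) \<Rightarrow> (nat \<times> nat \<Rightarrow> 's) \<Rightarrow> 'k \<Rightarrow> nat \<Rightarrow> nat" where
  "ftilde h \<sigma> x N = Bit_Operations.xor (ftilde_a h \<sigma> x N) (ftilde_c h \<sigma> x N)"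

end

theory Submission
  imports Defs "HOL-Library.Discrete_Functions"
begin

text \<open>The correction \<open>c\<close> only touches the bits below the leading bit of \<open>a\<close>. Hence \<open>a \<oplus> c\<close>
  lies below \<open>2 ^ r\<close> only if \<open>a\<close> does; then reducing \<open>a\<close> modulo \<open>2 ^ r\<close> leaves it unchanged,
  and with it \<open>b\<close>, \<open>c\<close> and \<open>a \<oplus> c\<close>.\<close>

unbundle bit_operations_syntax

lemma xor_nat_less_exp_iff:
  fixes a c k :: nat
  assumes "c < 2 ^ k"
  shows "a XOR c < 2 ^ k \<longleftrightarrow> a < 2 ^ k"
proof -
  have "take_bit k (a XOR c) = take_bit k a XOR c"
    using assms by (simp add: take_bit_nat_eq_self)
  moreover have "take_bit k a XOR c = a XOR c \<longleftrightarrow> take_bit k a = a"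
    by (metis xor.assoc xor.right_neutral xor_self_eq)
  ultimately have "take_bit k (a XOR c) = a XOR c \<longleftrightarrow> take_bit k a = a"
    by simp
  then show ?thesis
    by (simp only: take_bit_nat_eq_self_iff)
qed

lemma xor_below_leading_bit_less_exp_iff:
  fixes a c r :: nat
  assumes c_less: "c < 2 ^ floor_log a"
  shows "a XOR c < 2 ^ r \<longleftrightarrow> a < 2 ^ r"
proof (cases "r < floor_log a")
  case True
  then have "(2::nat) ^ r < 2 ^ floor_log a"
    by simp
  moreover have exp_le: "2 ^ floor_log a \<le> a"
    using True by (intro floor_log_exp2_le) (cases a; simp)
  moreover from exp_le have "2 ^ floor_log a \<le> a XOR c"
    using xor_nat_less_exp_iff[OF c_less, of a] by simp
  ultimately show ?thesis
    by linarith
next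
  case False
  then have "(2::nat) ^ floor_log a \<le> 2 ^ r"
    by simp
  with c_less have "c < 2 ^ r"
    by (rule less_le_trans)
  then show ?thesis
    by (rule xor_nat_less_exp_iff)
qed

lemma ftilde_b_eq_floor_log: "ftilde_b h \<sigma> x N = floor_log (ftilde_a h \<sigma> x N)"
  by (simp add: ftilde_b_def floor_log_altdef)

lemma ftilde_less_exp_iff: "ftilde h \<sigma> x N < 2 ^ r \<longleftrightarrow> ftilde_a h \<sigma> x N < 2 ^ r"
  unfolding ftilde_def
  by (rule xor_below_leading_bit_less_exp_iff) (simp add: ftilde_c_def ftilde_b_eq_floor_log)

lemma ftilde_cong:
  assumes "ftilde_a h \<sigma> x M = ftilde_a h \<sigma> x N"
  shows "ftilde h \<sigma> x M = ftilde h \<sigma> x N"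
  using assms by (simp add: ftilde_def ftilde_c_def ftilde_b_eq_floor_log)

lemma ftilde_eq_if_less_exp:
  assumes dvd: "2 ^ r dvd N" and less: "ftilde h \<sigma> x N < 2 ^ r"
  shows "ftilde h \<sigma> x N = ftilde h \<sigma> x (2 ^ r)"
proof (rule ftilde_cong)
  have "ftilde_a h \<sigma> x N = ftilde_a h \<sigma> x N mod 2 ^ r"
    using less by (simp add: ftilde_less_exp_iff)
  also have "\<dots> = ftilde_a h \<sigma> x (2 ^ r)"
    using dvd by (simp add: ftilde_a_def mod_mod_cancel)
  finally show "ftilde_a h \<sigma> x N = ftilde_a h \<sigma> x (2 ^ r)" .
qed

theorem theorem2p1:
  fixes X :: "'k set" and \<Sigma> :: "'s set" and q m :: nat
    and h :: "'k \<Rightarrow> 's \<Rightarrow> nat" and \<sigma> :: "nat \<times> nat \<Rightarrow> 's"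
  assumes "finite X" and "X \<noteq> {}" and "q \<ge> 1"
    and "\<And>x. x \<in> X \<Longrightarrow> h x \<in> \<Sigma> \<rightarrow> {0..<2 ^ q}"
    and "\<sigma> \<in> {0..<q} \<times> {0..m} \<rightarrow> \<Sigma>"
    and "inj_on \<sigma> ({0..<q} \<times> {0..m})"
  shows "\<forall>x\<in>X. \<forall>r\<in>{0..q}. \<forall>r'\<in>{0..q}. r < r' \<longrightarrow>
           ftilde h \<sigma> x (2 ^ r') < 2 ^ r \<longrightarrow>
           ftilde h \<sigma> x (2 ^ r') = ftilde h \<sigma> x (2 ^ r)"
proof (intro ballI impI)
  fix x and r r' :: nat
  assume "r < r'" and less: "ftilde h \<sigma> x (2 ^ r') < 2 ^ r"
  then have "(2::nat) ^ r dvd 2 ^ r'"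
    by (simp add: le_imp_power_dvd)
  then show "ftilde h \<sigma> x (2 ^ r') = ftilde h \<sigma> x (2 ^ r)"
    using less by (rule ftilde_eq_if_less_exp)
qed

end
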